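(* Let $\mathcal{X}=\overline{([-x_1,x_2],0)}$ with $x_1,x_2>0$ and $x_1<x_2$. Then for any $\mathcal{Y}=\overline{([-y_1,y_2],0)}$ with $y_1,y_2>0$ and $\dfrac{x_1}{x_2}<\dfrac{y_2}{y_1}$, $\dfrac{x_1}{x_2}<\dfrac{y_1}{y_2}$, there is $\mathcal{Z}=\overline{([-z_1,z_2],0)}$ (with $[-z_1,z_2]$ an interval) such that $\mathcal{Y}=\mathcal{X}\bullet\mathcal{Z}$.
   Context: $\mathbb{IR}$ is the set of closed bounded intervals $[a,b]$ of $\mathbb{R}$, $a\le b$, with $0=[0,0]$ and addition $[a,b]+[c,d]=[a+c,b+d]$. $\overline{\mathbb{IR}}$ is the quotient of $\mathbb{IR}\times\mathbb{IR}$ by $(x,y)\sim(z,t)\iff x+t=y+z$, with classes $\overline{(x,y)}$. $\mathcal{A}_4$ is the 4-dimensional real algebra with product $x\cdot y=(x_1y_1+x_4y_4,\;x_2y_2+x_3y_3,\;x_3y_2+x_2y_3,\;x_4y_1+x_1y_4)$. The injective map $\varphi:\mathbb{IR}\to\mathcal{A}_4$ sends $[a,b]$ to $(a,b,0,0)$ if $a,b\ge0$, to $(0,b,-a,0)$ if $a\le0\le b$, and to $(0,0,-a,-b)$ if $a,b\le0$. For $K,L\in\mathbb{IR}$ the element $\varphi(K)\cdot\varphi(L)$ lies in the image of $\varphi$ and $\overline{(K,0)}\bullet\overline{(L,0)}=\overline{(\varphi^{-1}(\varphi(K)\cdot\varphi(L)),0)}$. *)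

theory Defs
  imports "HOL-Analysis.Analysis" "HOL-Library.Interval"
begin

text \<open>
  Closed bounded nonempty real intervals are the library type \<^typ>\<open>real interval\<close>, whose addition
  and zero are the endpointwise ones; \<open>Interval (a, b)\<close> denotes $[a,b]$ when \<open>a \<le> b\<close> and is
  unspecified otherwise.
\<close>

definition ir_rel :: "real interval \<times> real interval \<Rightarrow> real interval \<times> real interval \<Rightarrow> bool" where
  "ir_rel = (\<lambda>(x, y) (z, t). x + t = y + z)"

lemma equivp_ir_rel: "equivp ir_rel"
  by (rule equivpI) (auto simp: ir_rel_def interval_eq_iff reflp_def symp_def transp_def)

quotient_type ir_bar = "real interval \<times> real interval" / ir_rel
  morphisms rep_ir_bar ir_class
  by (rule equivp_ir_rel)

lemma ir_class_eq_iff: "ir_class (x, y) = ir_class (z, t) \<longleftrightarrow> x + t = y + z"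
  by (simp add: ir_bar.abs_eq_iff ir_rel_def)

abbreviation ir_embed :: "real interval \<Rightarrow> ir_bar" where
  "ir_embed K \<equiv> ir_class (K, 0)"

lemma inj_ir_embed: "inj ir_embed"
  by (auto simp: inj_def ir_class_eq_iff interval_eq_iff)

lemma vector_4 [simp]:
  "(vector [w, x, y, z] :: real^4) $ 1 = w"
  "(vector [w, x, y, z] :: real^4) $ 2 = x"
  "(vector [w, x, y, z] :: real^4) $ 3 = y"
  "(vector [w, x, y, z] :: real^4) $ 4 = z"
  by (simp_all add: vector_def)

text \<open>The algebra $\mathcal{A}_4$ is the vector space \<^typ>\<open>real^4\<close> with the following product.\<close>

definition A4_mult :: "real^4 \<Rightarrow> real^4 \<Rightarrow> real^4" (infixl \<open>\<cdot>\<^sub>A\<close> 70) where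
  "x \<cdot>\<^sub>A y = vector
    [x$1 * y$1 + x$4 * y$4,
     x$2 * y$2 + x$3 * y$3,
     x$3 * y$2 + x$2 * y$3,
     x$4 * y$1 + x$1 * y$4]"

definition ir_phi :: "real interval \<Rightarrow> real^4" where
  "ir_phi K = (let a = lower K; b = upper K in
     if 0 \<le> a \<and> 0 \<le> b then vector [a, b, 0, 0]
     else if a \<le> 0 \<and> 0 \<le> b then vector [0, b, - a, 0]
     else vector [0, 0, - a, - b])"

lemma lower_Interval: "a \<le> b \<Longrightarrow> lower (Interval (a, b)) = (a::real)"
  and upper_Interval: "a \<le> b \<Longrightarrow> upper (Interval (a, b)) = (b::real)"
  by (simp_all add: lower.rep_eq upper.rep_eq Interval_inverse)

lemma vec4_eq_iff: "(x::real^4) = y \<longleftrightarrow> x$1 = y$1 \<and> x$2 = y$2 \<and> x$3 = y$3 \<and> x$4 = y$4"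
  by (simp add: vec_eq_iff forall_4)

text \<open>The three cases in the definition of $\varphi$ agree where they overlap.\<close>

lemma ir_phi_nonneg: "0 \<le> a \<Longrightarrow> a \<le> b \<Longrightarrow> ir_phi (Interval (a, b)) = vector [a, b, 0, 0]"
  by (simp add: ir_phi_def lower_Interval upper_Interval)

lemma ir_phi_mid: "a \<le> 0 \<Longrightarrow> 0 \<le> b \<Longrightarrow> ir_phi (Interval (a, b)) = vector [0, b, - a, 0]"
  by (auto simp: ir_phi_def lower_Interval upper_Interval vec4_eq_iff)

lemma ir_phi_nonpos: "a \<le> b \<Longrightarrow> b \<le> 0 \<Longrightarrow> ir_phi (Interval (a, b)) = vector [0, 0, - a, - b]"
  by (auto simp: ir_phi_def lower_Interval upper_Interval vec4_eq_iff)

lemma inj_ir_phi: "inj ir_phi"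
proof (rule injI)
  fix K L :: "real interval"
  assume "ir_phi K = ir_phi L"
  with lower_le_upper[of K] lower_le_upper[of L] show "K = L"
    by (auto simp: ir_phi_def Let_def vec4_eq_iff interval_eq_iff split: if_splits)
qed

lemma range_ir_phi:
  "v \<in> range ir_phi \<longleftrightarrow>
     0 \<le> v$1 \<and> v$1 \<le> v$2 \<and> v$3 = 0 \<and> v$4 = 0 \<or>
     v$1 = 0 \<and> 0 \<le> v$2 \<and> 0 \<le> v$3 \<and> v$4 = 0 \<or>
     v$1 = 0 \<and> v$2 = 0 \<and> 0 \<le> v$4 \<and> v$4 \<le> v$3" (is "_ \<longleftrightarrow> ?A \<or> ?B \<or> ?C")
proof
  assume "v \<in> range ir_phi"
  then obtain K where K: "v = ir_phi K" by blast
  show "?A \<or> ?B \<or> ?C"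
    using lower_le_upper[of K] by (auto simp: K ir_phi_def Let_def)
next
  assume "?A \<or> ?B \<or> ?C"
  then consider ?A | ?B | ?C by blast
  then show "v \<in> range ir_phi"
  proof cases
    case 1
    then have "v = ir_phi (Interval (v$1, v$2))" by (simp add: ir_phi_nonneg vec4_eq_iff)
    then show ?thesis by blast
  next
    case 2
    then have "v = ir_phi (Interval (- v$3, v$2))" by (simp add: ir_phi_mid vec4_eq_iff)
    then show ?thesis by blast
  next
    case 3
    then have "v = ir_phi (Interval (- v$3, - v$4))" by (simp add: ir_phi_nonpos vec4_eq_iff)
    then show ?thesis by blast
  qed
qed

lemma A4_mult_in_range: "ir_phi K \<cdot>\<^sub>A ir_phi L \<in> range ir_phi"
proof -
  have m: "a * c \<le> b * d" if "0 \<le> a" "a \<le> b" "0 \<le> c" "c \<le> d" for a b c d :: real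
    using that by (intro mult_mono) auto
  have "u \<cdot>\<^sub>A v \<in> range ir_phi" if "u \<in> range ir_phi" "v \<in> range ir_phi" for u v
    using that unfolding range_ir_phi
    by (elim disjE)
       ((rule disjI1, simp add: A4_mult_def m; fail) |
        (rule disjI2, rule disjI1, simp add: A4_mult_def m; fail) |
        (rule disjI2, rule disjI2, simp add: A4_mult_def m; fail))+
  then show ?thesis by blast
qed

text \<open>
  The product is only specified on classes $\overline{(K,0)}$; outside that domain the value below
  is arbitrary.  Both inverses are unambiguous by \<open>inj_ir_embed\<close> and \<open>inj_ir_phi\<close>.
\<close>

definition ir_mult :: "ir_bar \<Rightarrow> ir_bar \<Rightarrow> ir_bar" (infixl \<open>\<bullet>\<^sub>I\<close> 70) where
  "X \<bullet>\<^sub>I Y = ir_embed (inv ir_phi (ir_phi (inv ir_embed X) \<cdot>\<^sub>A ir_phi (inv ir_embed Y)))"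

lemma ir_mult_embed:
  "ir_class (K, 0) \<bullet>\<^sub>I ir_class (L, 0) = ir_class (inv ir_phi (ir_phi K \<cdot>\<^sub>A ir_phi L), 0)"
  using inv_f_f[OF inj_ir_embed] by (simp add: ir_mult_def)

end

theory Submission
  imports Defs
begin

text \<open>
  All zero-straddling intervals are mapped by \<open>ir_phi\<close> into the coordinate plane
  \<open>(0, *, *, 0)\<close>, where the product of the algebra is that of the split-complex numbers: with
  $[-p,q]$ read as $q + pj$, $j^2 = 1$, division by $[-x_1,x_2]$ is multiplication by
  $(x_2 - x_1 j)/(x_2^2 - x_1^2)$.  The quotient thus has the candidate endpoints
  $z_2 = (x_2y_2 - x_1y_1)/(x_2^2-x_1^2)$ and $z_1 = (x_2y_1 - x_1y_2)/(x_2^2-x_1^2)$.  Here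
  $x_1 < x_2$ makes the denominator positive, and the two inequalities between the ratios are
  exactly the positivity of the two numerators, so that the quotient straddles zero again and
  the product formula of lemma \<open>ir_mult_straddling\<close> applies to it.
\<close>

text \<open>
  Both factors and the result fall under the middle case of \<open>ir_phi\<close>, so multiplying the
  images and pulling back along \<open>ir_phi\<close> stays within that case.
\<close>

lemma ir_mult_straddling:
  assumes "0 \<le> p" "0 \<le> q" "0 \<le> r" "0 \<le> s"
  shows "ir_embed (Interval (- p, q)) \<bullet>\<^sub>I ir_embed (Interval (- r, s)) =
         ir_embed (Interval (- (p * s + q * r), q * s + p * r))"
proof -
  have "ir_phi (Interval (- p, q)) \<cdot>\<^sub>A ir_phi (Interval (- r, s)) =
        ir_phi (Interval (- (p * s + q * r), q * s + p * r))"
    using assms by (simp add: ir_phi_mid A4_mult_def vec4_eq_iff del: minus_add_distrib)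
  then show ?thesis
    by (simp only: ir_mult_embed inv_f_f[OF inj_ir_phi])
qed

theorem proposition22:
  fixes x1 x2 y1 y2 :: real and X Y :: ir_bar
  assumes "X = ir_class (Interval (- x1, x2), 0)"
    and "0 < x1" and "0 < x2" and "x1 < x2"
    and "Y = ir_class (Interval (- y1, y2), 0)"
    and "0 < y1" and "0 < y2"
    and "x1 / x2 < y2 / y1" and "x1 / x2 < y1 / y2"
  shows "\<exists>(Z :: ir_bar) (z1 :: real) (z2 :: real).
           - z1 \<le> z2 \<and> Z = ir_class (Interval (- z1, z2), 0) \<and> Y = X \<bullet>\<^sub>I Z"
proof -
  define d where "d = x2 * x2 - x1 * x1"
  define z1 where "z1 = (x2 * y1 - x1 * y2) / d"
  define z2 where "z2 = (x2 * y2 - x1 * y1) / d"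
  have d: "0 < d"
    using assms(2-4) by (simp add: d_def mult_strict_mono)
  have z: "0 \<le> z1" "0 \<le> z2"
    using assms(2,3,6-9) d by (simp_all add: z1_def z2_def field_simps)
  have y1: "x1 * z2 + x2 * z1 = y1"
  proof -
    have "x1 * z2 + x2 * z1 = (d * y1) / d"
      unfolding z1_def z2_def times_divide_eq_right add_divide_distrib[symmetric]
      by (simp add: d_def algebra_simps)
    then show ?thesis using d by simp
  qed
  have y2: "x2 * z2 + x1 * z1 = y2"
  proof -
    have "x2 * z2 + x1 * z1 = (d * y2) / d"
      unfolding z1_def z2_def times_divide_eq_right add_divide_distrib[symmetric]
      by (simp add: d_def algebra_simps)
    then show ?thesis using d by simp
  qed
  have "X \<bullet>\<^sub>I ir_embed (Interval (- z1, z2)) = Y"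
    using ir_mult_straddling[of x1 x2 z1 z2] assms(2,3) z
    unfolding assms(1,5) y1 y2 by simp
  then show ?thesis
    using z by (intro exI[of _ "ir_embed (Interval (- z1, z2))"] exI[of _ z1] exI[of _ z2]) simp
qed

end
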